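(* Let $n\ge 2$ be an integer and let $SD_{8n}=\langle a,b : a^{4n}=b^2=1,\ bab^{-1}=a^{2n-1}\rangle$ be the semidihedral group. Then \[ \mathrm{CSCom}(SD_{8n})\cong\begin{cases}K_2\vee(K_{4n-2}\sqcup 2K_{2n}), & \text{if } n \text{ is even},\\ K_4\vee(K_{4n-4}\sqcup K_{4n}), & \text{if } n \text{ is odd}.\end{cases} \]
   Context: For a finite group $G$, the conjugacy super commuting graph $\mathrm{CSCom}(G)$ is the simple graph with vertex set $G$ in which two distinct vertices $g,h$ are adjacent if and only if either $g$ and $h$ are conjugate in $G$, or there exist $g'$ in the conjugacy class of $g$ and $h'$ in the conjugacy class of $h$ with $g'h'=h'g'$. $K_r$ is the complete graph on $r$ vertices, $\sqcup$ is disjoint union of graphs, $mK_r$ is the disjoint union of $m$ copies of $K_r$, and $\vee$ is the join of graphs (disjoint union together with all edges between the two vertex sets). *)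

theory Defs
  imports
    "HOL-Algebra.Group"
    "Graph_Theory.Pair_Digraph"
    "Graph_Theory.Digraph_Isomorphism"
begin

section \<open>Groups given by generators and relations\<close>

datatype 'g letter = Gen 'g | Inv 'g

text \<open>
  The relations are pairs of words, to be read as equations between words. Two words are congruent
  if and only if they represent the same element of the presented group.
\<close>

inductive_set word_cong :: "('g letter list \<times> 'g letter list) set \<Rightarrow> ('g letter list \<times> 'g letter list) set"
  for R where
    rel: "(r, s) \<in> R \<Longrightarrow> (u @ r @ v, u @ s @ v) \<in> word_cong R"
  | cancel_right: "(u @ [Gen x, Inv x] @ v, u @ v) \<in> word_cong R"
  | cancel_left: "(u @ [Inv x, Gen x] @ v, u @ v) \<in> word_cong R"
  | refl: "(u, u) \<in> word_cong R"
  | sym: "(u, v) \<in> word_cong R \<Longrightarrow> (v, u) \<in> word_cong R"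
  | trans: "(u, v) \<in> word_cong R \<Longrightarrow> (v, w) \<in> word_cong R \<Longrightarrow> (u, w) \<in> word_cong R"

definition presented_group :: "('g letter list \<times> 'g letter list) set \<Rightarrow> 'g letter list set monoid" where
  "presented_group R = \<lparr>
     carrier = UNIV // word_cong R,
     monoid.mult = (\<lambda>A B. \<Union>u\<in>A. \<Union>v\<in>B. word_cong R `` {u @ v}),
     monoid.one = word_cong R `` {[]} \<rparr>"

lemma equiv_word_cong: "equiv UNIV (word_cong R)"
proof (rule equivI)
  show "refl (word_cong R)"
    by (rule refl_onI) (simp add: word_cong.refl)
  show "sym (word_cong R)"
    by (rule symI) (rule word_cong.sym)
  show "trans (word_cong R)"
    by (rule transI) (rule word_cong.trans)
qed simp

lemma word_cong_context:
  assumes "(u, v) \<in> word_cong R"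
  shows "(p @ u @ q, p @ v @ q) \<in> word_cong R"
  using assms
proof induction
  case (rel r s u v)
  then show ?case using word_cong.rel[of r s R "p @ u" "v @ q"] by simp
next
  case (cancel_right u x v)
  then show ?case using word_cong.cancel_right[of "p @ u" x "v @ q"] by simp
next
  case (cancel_left u x v)
  then show ?case using word_cong.cancel_left[of "p @ u" x "v @ q"] by simp
next
  case (refl u)
  show ?case by (rule word_cong.refl)
next
  case (sym u v)
  show ?case by (rule word_cong.sym[OF sym.IH])
next
  case (trans u v w)
  show ?case by (rule word_cong.trans[OF trans.IH])
qed

lemma word_cong_append:
  assumes "(u, u') \<in> word_cong R" "(v, v') \<in> word_cong R"
  shows "(u @ v, u' @ v') \<in> word_cong R"
  using word_cong.trans[OF word_cong_context[OF assms(1), of "[]" v, simplified]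
      word_cong_context[OF assms(2), of u' "[]", simplified]] .

lemma presented_group_mult:
  "word_cong R `` {u} \<otimes>\<^bsub>presented_group R\<^esub> word_cong R `` {v} = word_cong R `` {u @ v}"
proof -
  have "word_cong R `` {u' @ v'} = word_cong R `` {u @ v}"
    if "(u, u') \<in> word_cong R" "(v, v') \<in> word_cong R" for u' v'
    using equiv_class_eq[OF equiv_word_cong word_cong_append[OF that]] by simp
  moreover have "u \<in> word_cong R `` {u}" "v \<in> word_cong R `` {v}"
    by (simp_all add: word_cong.refl)
  ultimately have "(\<Union>u'\<in>word_cong R `` {u}. \<Union>v'\<in>word_cong R `` {v}. word_cong R `` {u' @ v'})
      = word_cong R `` {u @ v}"
    by blast
  then show ?thesis
    by (simp add: presented_group_def)
qed

primrec letter_inv :: "'g letter \<Rightarrow> 'g letter" where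
  "letter_inv (Gen x) = Inv x"
| "letter_inv (Inv x) = Gen x"

lemma word_cong_inverse: "(rev (map letter_inv w) @ w, []) \<in> word_cong R"
proof (induction w)
  case Nil
  show ?case by (simp add: word_cong.refl)
next
  case (Cons l w)
  have "(rev (map letter_inv w) @ [letter_inv l, l] @ w, rev (map letter_inv w) @ w) \<in> word_cong R"
    by (cases l) (simp_all only: letter_inv.simps word_cong.cancel_left word_cong.cancel_right)
  from word_cong.trans[OF this Cons.IH] show ?case by simp
qed

lemma presented_group_is_group: "group (presented_group R)"
proof (rule groupI)
  have car: "carrier (presented_group R) = range (\<lambda>w. word_cong R `` {w})"
    by (auto simp: presented_group_def quotient_def)
  have one: "\<one>\<^bsub>presented_group R\<^esub> = word_cong R `` {[]}"
    by (simp add: presented_group_def)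
  note simps = car one presented_group_mult
  show "\<one>\<^bsub>presented_group R\<^esub> \<in> carrier (presented_group R)"
    by (simp add: simps)
  fix x assume x: "x \<in> carrier (presented_group R)"
  then show "\<one>\<^bsub>presented_group R\<^esub> \<otimes>\<^bsub>presented_group R\<^esub> x = x"
    by (auto simp: simps)
  obtain w where w: "x = word_cong R `` {w}"
    using x by (auto simp: car)
  have "word_cong R `` {rev (map letter_inv w)} \<otimes>\<^bsub>presented_group R\<^esub> x = \<one>\<^bsub>presented_group R\<^esub>"
    unfolding w presented_group_mult one
    by (rule equiv_class_eq[OF equiv_word_cong word_cong_inverse])
  then show "\<exists>y\<in>carrier (presented_group R). y \<otimes>\<^bsub>presented_group R\<^esub> x = \<one>\<^bsub>presented_group R\<^esub>"
    by (auto simp: car)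
  fix y assume y: "y \<in> carrier (presented_group R)"
  show "x \<otimes>\<^bsub>presented_group R\<^esub> y \<in> carrier (presented_group R)"
    using x y by (auto simp: simps)
  fix z assume "z \<in> carrier (presented_group R)"
  then show "x \<otimes>\<^bsub>presented_group R\<^esub> y \<otimes>\<^bsub>presented_group R\<^esub> z
      = x \<otimes>\<^bsub>presented_group R\<^esub> (y \<otimes>\<^bsub>presented_group R\<^esub> z)"
    using x y by (auto simp: simps)
qed

datatype sd_gen = a | b

definition semidihedral_group :: "nat \<Rightarrow> sd_gen letter list set monoid" where
  "semidihedral_group n = presented_group
     {(replicate (4 * n) (Gen a), []),
      ([Gen b, Gen b], []),
      ([Gen b, Gen a, Inv b], replicate (2 * n - 1) (Gen a))}"

hide_const (open) a b

section \<open>Conjugacy super commuting graphs\<close>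

text \<open>
  Simple graphs are symmetric loopless digraphs, so that each edge is present as two opposite arcs.
\<close>

definition conj_class :: "('a, 'm) monoid_scheme \<Rightarrow> 'a \<Rightarrow> 'a set" where
  "conj_class G g = {x \<otimes>\<^bsub>G\<^esub> g \<otimes>\<^bsub>G\<^esub> inv\<^bsub>G\<^esub> x | x. x \<in> carrier G}"

definition CSCom :: "('a, 'm) monoid_scheme \<Rightarrow> 'a pair_pre_digraph" where
  "CSCom G = \<lparr>
     pverts = carrier G,
     parcs = {(g, h). g \<in> carrier G \<and> h \<in> carrier G \<and> g \<noteq> h \<and>
       (h \<in> conj_class G g \<or>
        (\<exists>g'\<in>conj_class G g. \<exists>h'\<in>conj_class G h. g' \<otimes>\<^bsub>G\<^esub> h' = h' \<otimes>\<^bsub>G\<^esub> g'))} \<rparr>"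

definition complete_graph :: "nat \<Rightarrow> nat pair_pre_digraph" where
  "complete_graph r = \<lparr> pverts = {..<r}, parcs = {(i, j). i < r \<and> j < r \<and> i \<noteq> j} \<rparr>"

definition disjoint_union ::
  "'a pair_pre_digraph \<Rightarrow> 'b pair_pre_digraph \<Rightarrow> ('a + 'b) pair_pre_digraph" where
  "disjoint_union G H = \<lparr>
     pverts = pverts G <+> pverts H,
     parcs = map_prod Inl Inl ` parcs G \<union> map_prod Inr Inr ` parcs H \<rparr>"

definition graph_join ::
  "'a pair_pre_digraph \<Rightarrow> 'b pair_pre_digraph \<Rightarrow> ('a + 'b) pair_pre_digraph" where
  "graph_join G H = \<lparr>
     pverts = pverts (disjoint_union G H),
     parcs = parcs (disjoint_union G H)
       \<union> (Inl ` pverts G) \<times> (Inr ` pverts H) \<union> (Inr ` pverts H) \<times> (Inl ` pverts G) \<rparr>"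

definition copies :: "nat \<Rightarrow> 'a pair_pre_digraph \<Rightarrow> (nat \<times> 'a) pair_pre_digraph" where
  "copies m G = \<lparr>
     pverts = {..<m} \<times> pverts G,
     parcs = {((i, u), (i, v)) | i u v. i < m \<and> (u, v) \<in> parcs G} \<rparr>"

end

theory Submission
  imports Defs "HOL-Number_Theory.Cong"
begin

text \<open>
  Two vertices \<open>g\<close>, \<open>h\<close> are adjacent in the conjugacy super commuting graph exactly when some conjugate of
  \<open>g\<close> commutes with \<open>h\<close>: a commuting pair of conjugates can be conjugated simultaneously until
  its second member is \<open>h\<close>, and conjugate elements are covered because \<open>h\<close> commutes with itself
  (\<open>CSCom_arc_iff\<close>). So everything is decided by solving congruences modulo \<open>4n\<close>.
  
  To compute in the presented group one needs its normal form: every element is \<open>a^i b^e\<close>, and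
  these \<open>8n\<close> elements are distinct. The presentation gives the first half, and for the second half
  the generators are evaluated in an explicit group of order \<open>8n\<close> on pairs \<open>(i, e)\<close>
  (\<open>semidihedral_iso_model\<close>).
  
  In that group, conjugation and commutation come down to the number \<open>d\<close>, equal to \<open>2n\<close> for even \<open>n\<close>
  and to \<open>n\<close> for odd \<open>n\<close>: since \<open>b\<close> acts on exponents as multiplication by \<open>2n - 1\<close>, the
  obstruction to commuting is a multiple of \<open>2n - 2\<close>, and \<open>(2n - 2) x\<close> vanishes modulo \<open>4n\<close> iff \<open>d\<close>
  divides \<open>x\<close>. Hence a rotation \<open>a^i\<close> commutes with a reflection \<open>a^l b\<close> iff \<open>d\<close> divides \<open>i\<close>,
  that is, iff \<open>a^i\<close> is central. All rotations commute with each other. Two reflections are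
  adjacent for odd \<open>n\<close> always, and for even \<open>n\<close> iff their exponents have the same parity.
  
  Adjacency of distinct elements therefore depends only on a colour: central elements are joined to
  everything, other elements to those of their own colour. The graphs on the right-hand side have the
  same shape, and finite graphs of this shape are isomorphic as soon as each colour occurs
  equally often in both (\<open>blow_up_iso\<close>). It remains to count: there are \<open>4n / d\<close> central rotations, and the
  reflections of either parity number \<open>2n\<close>.
\<close>

section \<open>Graphs determined by a vertex colouring\<close>

text \<open>
  Adjacency of distinct vertices is decided by their colours alone. The graph is then obtained from the
  graph \<open>R\<close> on colours by replacing each colour with a clique, or with an independent set
  where \<open>R\<close> is not reflexive.
\<close>

definition blow_up :: "('c \<Rightarrow> 'c \<Rightarrow> bool) \<Rightarrow> ('a \<Rightarrow> 'c) \<Rightarrow> 'a pair_pre_digraph \<Rightarrow> bool" where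
  "blow_up R c P \<longleftrightarrow> finite (pverts P) \<and>
     parcs P = {(u, v). u \<in> pverts P \<and> v \<in> pverts P \<and> u \<noteq> v \<and> R (c u) (c v)}"

lemma bij_betw_of_fibres:
  assumes fin: "finite A" "finite B"
    and card_eq: "\<And>k. card {x \<in> A. c x = k} = card {y \<in> B. d y = k}"
  obtains f where "bij_betw f A B" "\<And>x. x \<in> A \<Longrightarrow> d (f x) = c x"
proof -
  have "\<exists>h. bij_betw h {x \<in> A. c x = k} {y \<in> B. d y = k}" for k
    using fin card_eq[of k] by (intro finite_same_card_bij) auto
  then obtain h where h: "\<And>k. bij_betw (h k) {x \<in> A. c x = k} {y \<in> B. d y = k}"
    by metis
  define f where "f x = h (c x) x" for x
  have f: "f x \<in> B" "d (f x) = c x" if "x \<in> A" for x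
    using bij_betwE[OF h[of "c x"]] that unfolding f_def by auto
  have "inj_on f A"
  proof (rule inj_onI)
    fix x y assume "x \<in> A" "y \<in> A" "f x = f y"
    moreover from this have "c x = c y" using f(2) by metis
    ultimately show "x = y"
      using bij_betw_imp_inj_on[OF h[of "c x"]] unfolding f_def by (auto dest: inj_onD)
  qed
  moreover have "B \<subseteq> f ` A"
  proof
    fix y assume "y \<in> B"
    then have "y \<in> h (d y) ` {x \<in> A. c x = d y}"
      using bij_betw_imp_surj_on[OF h[of "d y"]] by auto
    then show "y \<in> f ` A" unfolding f_def by force
  qed
  ultimately have "bij_betw f A B" using f(1) by (auto simp: bij_betw_def)
  then show ?thesis using f(2) that by blast
qed

text \<open>
  Any bijection that preserves colours preserves arcs, and equal colour counts provide one.
\<close>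

lemma blow_up_iso:
  assumes P: "blow_up R c P" and Q: "blow_up R d Q"
    and card_eq: "\<And>k. card {u \<in> pverts P. c u = k} = card {v \<in> pverts Q. d v = k}"
  shows "digraph_iso (with_proj P) (with_proj Q)"
proof -
  obtain f where f: "bij_betw f (pverts P) (pverts Q)"
      and col: "\<And>u. u \<in> pverts P \<Longrightarrow> d (f u) = c u"
    using bij_betw_of_fibres[of "pverts P" "pverts Q" c d] P Q card_eq
    unfolding blow_up_def by metis
  have inj: "inj_on f (pverts P)" and img: "f ` pverts P = pverts Q"
    using f by (auto simp: bij_betw_def)
  have sub: "parcs P \<subseteq> pverts P \<times> pverts P" using P by (auto simp: blow_up_def)
  let ?F = "\<lparr>iso_verts = f, iso_arcs = map_prod f f, iso_head = snd, iso_tail = fst\<rparr>"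
  have "inj_on (map_prod f f) (parcs P)"
    by (rule inj_on_subset[OF map_prod_inj_on[OF inj inj] sub])
  moreover have "wf_digraph (with_proj P)"
    using sub by unfold_locales auto
  ultimately have "pre_digraph.digraph_isomorphism (with_proj P) ?F"
    using inj by (auto simp: pre_digraph.digraph_isomorphism_def)
  moreover have "parcs Q = map_prod f f ` parcs P"
  proof -
    have "parcs Q = {(u, v). u \<in> f ` pverts P \<and> v \<in> f ` pverts P \<and> u \<noteq> v \<and> R (d u) (d v)}"
      using Q img by (simp add: blow_up_def)
    also have "\<dots> = map_prod f f ` {(u, v). u \<in> pverts P \<and> v \<in> pverts P \<and> u \<noteq> v \<and> R (c u) (c v)}"
      using inj by (force simp: col dest: inj_onD)
    finally show ?thesis using P by (simp add: blow_up_def)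
  qed
  then have "with_proj Q = app_iso ?F (with_proj P)"
    using img by (simp add: app_iso_def with_proj_def)
  ultimately show ?thesis unfolding digraph_iso_def by blast
qed

section \<open>Adjacency in the conjugacy super commuting graph\<close>

text \<open>
  The element \<open>k\<close> is a conjugate of \<open>g\<close>, written as \<open>k x = x g\<close> so that computations in a concrete
  group involve no inverses. If conjugates \<open>g'\<close> of \<open>g\<close> and \<open>h' = y h y^-1\<close> of \<open>h\<close> commute, then
  \<open>k = y^-1 g' y\<close> is a conjugate of \<open>g\<close> that commutes with \<open>h\<close>.
\<close>

lemma (in group) CSCom_arc_iff:
  assumes g: "g \<in> carrier G" and h: "h \<in> carrier G"
  shows "(g, h) \<in> parcs (CSCom G) \<longleftrightarrow> g \<noteq> h \<and>
    (\<exists>k\<in>carrier G. \<exists>x\<in>carrier G. k \<otimes> x = x \<otimes> g \<and> k \<otimes> h = h \<otimes> k)"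
    (is "_ \<longleftrightarrow> _ \<and> ?C")
proof -
  have class_iff: "k \<in> conj_class G u \<longleftrightarrow> k \<in> carrier G \<and> (\<exists>x\<in>carrier G. k \<otimes> x = x \<otimes> u)"
    if "u \<in> carrier G" for k u
  proof
    assume "k \<in> conj_class G u"
    then obtain x where "x \<in> carrier G" "k = x \<otimes> u \<otimes> inv x"
      unfolding conj_class_def by blast
    then show "k \<in> carrier G \<and> (\<exists>x\<in>carrier G. k \<otimes> x = x \<otimes> u)"
      using that by (intro conjI bexI[of _ x]) (simp_all add: m_assoc)
  next
    assume "k \<in> carrier G \<and> (\<exists>x\<in>carrier G. k \<otimes> x = x \<otimes> u)"
    then obtain x where "k \<in> carrier G" "x \<in> carrier G" "k \<otimes> x = x \<otimes> u"
      by blast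
    then have "k = x \<otimes> u \<otimes> inv x"
      using that by (simp add: inv_solve_right)
    with \<open>x \<in> carrier G\<close> show "k \<in> conj_class G u"
      unfolding conj_class_def by blast
  qed
  have "?C" if "h \<in> conj_class G g"
    using that h by (auto simp: class_iff g)
  moreover have "?C" if g': "g' \<in> conj_class G g" and h': "h' \<in> conj_class G h"
      and comm: "g' \<otimes> h' = h' \<otimes> g'" for g' h'
  proof -
    obtain x where x: "x \<in> carrier G" "g' \<otimes> x = x \<otimes> g" and g'c: "g' \<in> carrier G"
      using g' g by (auto simp: class_iff)
    obtain y where y: "y \<in> carrier G" "h' = y \<otimes> h \<otimes> inv y"
      using h' by (auto simp: conj_class_def)
    let ?k = "inv y \<otimes> g' \<otimes> y"
    have h'c: "h' \<in> carrier G" using y h by simp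
    have yy: "y \<otimes> (inv y \<otimes> q) = q" "inv y \<otimes> (y \<otimes> q) = q" if "q \<in> carrier G" for q
      using that y(1) by (simp_all flip: m_assoc)
    have "?k \<otimes> (inv y \<otimes> x) = inv y \<otimes> (g' \<otimes> x)"
      using g'c x(1) y(1) by (simp add: m_assoc yy)
    then have 1: "?k \<otimes> (inv y \<otimes> x) = inv y \<otimes> x \<otimes> g"
      using g x y(1) by (simp add: m_assoc)
    have hy: "h = inv y \<otimes> h' \<otimes> y"
      using y h by (simp add: m_assoc yy)
    have cancel: "(inv y \<otimes> p \<otimes> y) \<otimes> (inv y \<otimes> q \<otimes> y) = inv y \<otimes> (p \<otimes> q) \<otimes> y"
      if "p \<in> carrier G" "q \<in> carrier G" for p q
      using that y(1) by (simp add: m_assoc yy)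
    have 2: "?k \<otimes> h = h \<otimes> ?k"
      unfolding hy by (simp add: cancel g'c h'c comm)
    show ?C
      by (rule bexI[of _ ?k], rule bexI[of _ "inv y \<otimes> x"]) (use 1 2 g'c x(1) y(1) in auto)
  qed
  moreover have "\<exists>g'\<in>conj_class G g. \<exists>h'\<in>conj_class G h. g' \<otimes> h' = h' \<otimes> g'" if C: ?C
  proof -
    have "h \<in> conj_class G h"
      using h by (auto simp: class_iff intro!: bexI[of _ \<one>])
    moreover obtain k where "k \<in> conj_class G g" "k \<otimes> h = h \<otimes> k"
      using C by (auto simp: class_iff[OF g])
    ultimately show ?thesis by blast
  qed
  ultimately show ?thesis
    using g h unfolding CSCom_def by auto
qed

lemma CSCom_arc_iso:
  assumes G: "group G" and H: "group H" and phi: "\<phi> \<in> iso G H"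
    and g: "g \<in> carrier G" and h: "h \<in> carrier G"
  shows "(g, h) \<in> parcs (CSCom G) \<longleftrightarrow> (\<phi> g, \<phi> h) \<in> parcs (CSCom H)"
proof -
  have img: "carrier H = \<phi> ` carrier G" and inj: "inj_on \<phi> (carrier G)"
    using phi by (auto simp: iso_def bij_betw_def)
  have mult: "\<phi> x \<otimes>\<^bsub>H\<^esub> \<phi> y = \<phi> (x \<otimes>\<^bsub>G\<^esub> y)" if "x \<in> carrier G" "y \<in> carrier G" for x y
    using phi that by (auto simp: iso_def hom_def)
  have [simp]: "\<phi> x = \<phi> y \<longleftrightarrow> x = y" if "x \<in> carrier G" "y \<in> carrier G" for x y
    using inj that by (auto dest: inj_onD)
  have [simp]: "x \<otimes>\<^bsub>G\<^esub> y \<in> carrier G" if "x \<in> carrier G" "y \<in> carrier G" for x y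
    using G that by (simp add: group.is_monoid monoid.m_closed)
  show ?thesis
    using g h by (simp add: group.CSCom_arc_iff[OF G] group.CSCom_arc_iff[OF H] img mult)
qed

section \<open>Homomorphisms out of a presented group\<close>

primrec word_value :: "('a, 'm) monoid_scheme \<Rightarrow> ('g \<Rightarrow> 'a) \<Rightarrow> 'g letter list \<Rightarrow> 'a" where
  "word_value H f [] = \<one>\<^bsub>H\<^esub>"
| "word_value H f (l # w) =
     (case l of Gen x \<Rightarrow> f x | Inv x \<Rightarrow> inv\<^bsub>H\<^esub> f x) \<otimes>\<^bsub>H\<^esub> word_value H f w"

context group
begin

lemma word_value_closed:
  assumes "\<And>x. f x \<in> carrier G"
  shows "word_value G f w \<in> carrier G"
  using assms by (induction w) (auto split: letter.split)

lemma word_value_append: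
  assumes "\<And>x. f x \<in> carrier G"
  shows "word_value G f (u @ v) = word_value G f u \<otimes> word_value G f v"
  using assms by (induction u) (auto simp: word_value_closed m_assoc split: letter.split)

lemma word_value_replicate:
  assumes "\<And>x. f x \<in> carrier G"
  shows "word_value G f (replicate k (Gen x)) = f x [^] k"
  using assms by (induction k) (auto simp flip: nat_pow_Suc2)

lemma word_value_cong:
  assumes f: "\<And>x. f x \<in> carrier G"
    and R: "\<And>r s. (r, s) \<in> R \<Longrightarrow> word_value G f r = word_value G f s"
    and uv: "(u, v) \<in> word_cong R"
  shows "word_value G f u = word_value G f v"
proof -
  have "f x \<otimes> (inv f x \<otimes> c) = c" "inv f x \<otimes> (f x \<otimes> c) = c" if "c \<in> carrier G" for x c
    using that f by (simp_all flip: m_assoc)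
  with uv show ?thesis
    by (induction rule: word_cong.induct) (simp_all add: R word_value_append f word_value_closed)
qed

text \<open>
  The universal property of a presentation (von Dyck): any choice of images for the generators that
  respects the relations extends to a homomorphism.
\<close>

lemma presented_group_hom:
  assumes f: "\<And>x. f x \<in> carrier G"
    and R: "\<And>r s. (r, s) \<in> R \<Longrightarrow> word_value G f r = word_value G f s"
  obtains \<phi> where "\<phi> \<in> hom (presented_group R) G"
    "\<And>w. \<phi> (word_cong R `` {w}) = word_value G f w"
proof -
  \<comment> \<open>The value is constant on each congruence class, so the image of a class is a singleton.\<close>
  define \<phi> where "\<phi> A = the_elem (word_value G f ` A)" for A
  have val: "\<phi> (word_cong R `` {w}) = word_value G f w" for w
  proof -
    have "word_value G f v = word_value G f w" if "(w, v) \<in> word_cong R" for v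
      using word_value_cong[of f R w v] f R that by simp
    moreover have "w \<in> word_cong R `` {w}"
      by (simp add: word_cong.refl)
    ultimately have "word_value G f ` (word_cong R `` {w}) = {word_value G f w}"
      by blast
    then show ?thesis by (simp add: \<phi>_def)
  qed
  have "\<phi> \<in> hom (presented_group R) G"
  proof (rule homI)
    fix A B assume "A \<in> carrier (presented_group R)" "B \<in> carrier (presented_group R)"
    then obtain u v where "A = word_cong R `` {u}" "B = word_cong R `` {v}"
      by (auto simp: presented_group_def quotient_def)
    then show "\<phi> (A \<otimes>\<^bsub>presented_group R\<^esub> B) = \<phi> A \<otimes> \<phi> B"
      by (simp add: presented_group_mult val word_value_append f)
  next
    fix A assume "A \<in> carrier (presented_group R)"
    then show "\<phi> A \<in> carrier G"
      by (auto simp: presented_group_def quotient_def val word_value_closed f)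
  qed
  then show ?thesis using val that by blast
qed

end

text \<open>
  Evaluating a word at the canonical generators gives back its own class. This allows words in the
  presented group to be handled as products and powers of group elements.
\<close>

lemma presented_group_word_value:
  "word_value (presented_group R) (\<lambda>x. word_cong R `` {[Gen x]}) w = word_cong R `` {w}"
proof (induction w)
  case Nil
  show ?case by (simp add: presented_group_def)
next
  case (Cons l w)
  let ?G = "presented_group R"
  have car: "word_cong R `` {v} \<in> carrier ?G" for v
    by (auto simp: presented_group_def quotient_def)
  have "inv\<^bsub>?G\<^esub> (word_cong R `` {[Gen x]}) = word_cong R `` {[Inv x]}" for x
  proof (rule group.inv_equality[OF presented_group_is_group])
    show "word_cong R `` {[Inv x]} \<otimes>\<^bsub>?G\<^esub> word_cong R `` {[Gen x]} = \<one>\<^bsub>?G\<^esub>"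
      using equiv_class_eq[OF equiv_word_cong word_cong.cancel_left[of "[]" x "[]" R]]
      by (simp add: presented_group_mult) (simp add: presented_group_def)
  qed (rule car)+
  then show ?case
    by (cases l) (simp_all add: Cons presented_group_mult)
qed

lemma presented_group_relation:
  assumes "(r, s) \<in> R"
  shows "word_value (presented_group R) (\<lambda>x. word_cong R `` {[Gen x]}) r
    = word_value (presented_group R) (\<lambda>x. word_cong R `` {[Gen x]}) s"
  unfolding presented_group_word_value
  using equiv_class_eq[OF equiv_word_cong word_cong.rel[OF assms, of "[]" "[]"]] by simp

section \<open>The semidihedral group in coordinates\<close>

text \<open>
  The action of \<open>b^e\<close> by conjugation on the exponents of \<open>a\<close>.
\<close>

definition sd_twist :: "nat \<Rightarrow> bool \<Rightarrow> int \<Rightarrow> int" where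
  "sd_twist n e i = (if e then (2 * int n - 1) * i else i)"

text \<open>
  The semidirect product of the integers modulo \<open>4n\<close> with a group of order 2, where \<open>(i, e)\<close> stands
  for \<open>a^i b^e\<close>. The Boolean component adds modulo 2, which is inequality.
\<close>

definition sd_model :: "nat \<Rightarrow> (int \<times> bool) monoid" where
  "sd_model n = \<lparr>
     carrier = {0..<4 * int n} \<times> UNIV,
     monoid.mult = (\<lambda>(i, e) (j, f). ((i + sd_twist n e j) mod (4 * int n), e \<noteq> f)),
     monoid.one = (0, False) \<rparr>"

lemma sd_twist_simps [simp]:
  "sd_twist n False i = i"
  "sd_twist n e 0 = 0"
  by (simp_all add: sd_twist_def)

lemma sd_twist_add: "sd_twist n e (i + j) = sd_twist n e i + sd_twist n e j"
  by (simp add: sd_twist_def algebra_simps)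

lemma sd_twist_mod: "[sd_twist n e (i mod (4 * int n)) = sd_twist n e i] (mod 4 * int n)"
  by (simp add: sd_twist_def cong_def mod_simps)

text \<open>
  The twist is an action because \<open>(2n - 1)^2 = 4n (n - 1) + 1\<close>.
\<close>

lemma sd_twist_twist:
  "[sd_twist n e (sd_twist n f i) = sd_twist n (e \<noteq> f) i] (mod 4 * int n)"
proof -
  have "(2 * int n - 1) * ((2 * int n - 1) * i) - i = 4 * int n * ((int n - 1) * i)"
    by (simp add: algebra_simps)
  then show ?thesis
    by (auto simp: sd_twist_def cong_iff_dvd_diff)
qed

lemma sd_model_simps:
  "carrier (sd_model n) = {0..<4 * int n} \<times> UNIV"
  "(i, e) \<otimes>\<^bsub>sd_model n\<^esub> (j, f) = ((i + sd_twist n e j) mod (4 * int n), e \<noteq> f)"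
  "\<one>\<^bsub>sd_model n\<^esub> = (0, False)"
  by (simp_all add: sd_model_def)

lemma sd_model_group:
  assumes "n > 0"
  shows "group (sd_model n)"
proof (rule groupI)
  fix x y z
  assume "x \<in> carrier (sd_model n)" "y \<in> carrier (sd_model n)" "z \<in> carrier (sd_model n)"
  obtain i e j f k g where xyz: "x = (i, e)" "y = (j, f)" "z = (k, g)"
    by (cases x, cases y, cases z) auto
  let ?m = "4 * int n"
  have "[sd_twist n e ((j + sd_twist n f k) mod ?m)
      = sd_twist n e j + sd_twist n e (sd_twist n f k)] (mod ?m)"
    using sd_twist_mod sd_twist_add by metis
  also have "[sd_twist n e j + sd_twist n e (sd_twist n f k)
      = sd_twist n e j + sd_twist n (e \<noteq> f) k] (mod ?m)"
    by (intro cong_add cong_refl sd_twist_twist)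
  finally have "[i + sd_twist n e ((j + sd_twist n f k) mod ?m)
      = i + (sd_twist n e j + sd_twist n (e \<noteq> f) k)] (mod ?m)"
    by (intro cong_add cong_refl)
  moreover have "(i + (sd_twist n e j + sd_twist n (e \<noteq> f) k)) mod ?m
      = ((i + sd_twist n e j) mod ?m + sd_twist n (e \<noteq> f) k) mod ?m"
    by (simp add: mod_simps add.assoc)
  ultimately have "((i + sd_twist n e j) mod ?m + sd_twist n (e \<noteq> f) k) mod ?m
      = (i + sd_twist n e ((j + sd_twist n f k) mod ?m)) mod ?m"
    by (simp only: cong_def)
  moreover have "((e \<noteq> f) \<noteq> g) = (e \<noteq> (f \<noteq> g))" by blast
  ultimately show "x \<otimes>\<^bsub>sd_model n\<^esub> y \<otimes>\<^bsub>sd_model n\<^esub> z = x \<otimes>\<^bsub>sd_model n\<^esub> (y \<otimes>\<^bsub>sd_model n\<^esub> z)"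
    by (simp only: xyz sd_model_simps)
next
  fix x assume x: "x \<in> carrier (sd_model n)"
  obtain i e where xi: "x = (i, e)" by (cases x)
  let ?m = "4 * int n"
  have "[- sd_twist n e i mod ?m + sd_twist n e i = - sd_twist n e i + sd_twist n e i] (mod ?m)"
    by (intro cong_add cong_refl) (simp add: cong_def)
  then have "(- sd_twist n e i mod ?m, e) \<otimes>\<^bsub>sd_model n\<^esub> x = \<one>\<^bsub>sd_model n\<^esub>"
    by (simp add: xi sd_model_simps cong_def)
  moreover have "(- sd_twist n e i mod ?m, e) \<in> carrier (sd_model n)"
    using assms by (simp add: sd_model_simps)
  ultimately show "\<exists>y\<in>carrier (sd_model n). y \<otimes>\<^bsub>sd_model n\<^esub> x = \<one>\<^bsub>sd_model n\<^esub>"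
    by (rule bexI)
  show "\<one>\<^bsub>sd_model n\<^esub> \<otimes>\<^bsub>sd_model n\<^esub> x = x"
    using x by (simp add: xi sd_model_simps)
next
  fix x y assume "x \<in> carrier (sd_model n)" "y \<in> carrier (sd_model n)"
  then show "x \<otimes>\<^bsub>sd_model n\<^esub> y \<in> carrier (sd_model n)"
    using assms by (cases x, cases y) (simp add: sd_model_simps)
next
  show "\<one>\<^bsub>sd_model n\<^esub> \<in> carrier (sd_model n)"
    using assms by (simp add: sd_model_simps)
qed

lemma sd_model_powers:
  assumes "n > 0"
  shows "(1, False) [^]\<^bsub>sd_model n\<^esub> (i :: int) = (i mod (4 * int n), False)"
proof -
  interpret group "sd_model n" by (rule sd_model_group[OF assms])
  have nat: "(1, False) [^]\<^bsub>sd_model n\<^esub> k = (int k mod (4 * int n), False)" for k :: nat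
  proof (induction k)
    case (Suc k)
    have "(int k mod (4 * int n) + 1) mod (4 * int n) = int (Suc k) mod (4 * int n)"
      by (metis mod_add_left_eq of_nat_Suc add.commute)
    then show ?case
      by (simp only: nat_pow_Suc Suc.IH sd_model_simps sd_twist_simps simp_thms)
  next
    case 0
    show ?case by (simp add: sd_model_simps(3))
  qed
  show ?thesis
  proof (cases i)
    case (nonneg k)
    show ?thesis by (simp only: nonneg int_pow_int nat)
  next
    case (neg k)
    have "(i mod (4 * int n) + int (Suc k) mod (4 * int n)) mod (4 * int n) = 0"
      unfolding mod_add_eq neg by simp
    then have "inv\<^bsub>sd_model n\<^esub> (int (Suc k) mod (4 * int n), False) = (i mod (4 * int n), False)"
      using assms by (intro inv_equality) (simp_all only: sd_model_simps sd_twist_simps, simp_all)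
    moreover have "(1, False) \<in> carrier (sd_model n)"
      using assms by (simp add: sd_model_simps)
    ultimately show ?thesis by (simp only: neg int_pow_neg_int nat)
  qed
qed

text \<open>
  The relations allow any word to be brought into the form \<open>a^i b^e\<close> with \<open>0 \<le> i < 4n\<close>, since
  \<open>b a^i = a^((2n - 1) i) b\<close>. The homomorphism to the model sends this element to \<open>(i, e)\<close>, so the
  normal forms are distinct and the homomorphism is bijective.
\<close>

lemma semidihedral_iso_model:
  assumes "n > 0"
  shows "\<exists>\<phi>. \<phi> \<in> iso (semidihedral_group n) (sd_model n)"
proof -
  let ?m = "4 * int n" and ?M = "sd_model n" and ?G = "semidihedral_group n"
  define R where "R =
     {(replicate (4 * n) (Gen sd_gen.a), []),
      ([Gen sd_gen.b, Gen sd_gen.b], []),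
      ([Gen sd_gen.b, Gen sd_gen.a, Inv sd_gen.b], replicate (2 * n - 1) (Gen sd_gen.a))}"
  have G: "?G = presented_group R"
    by (simp add: semidihedral_group_def R_def)
  interpret M: group ?M by (rule sd_model_group[OF assms])
  interpret G: group ?G unfolding G by (rule presented_group_is_group)
  define gen where "gen x = word_cong R `` {[Gen x :: sd_gen letter]}" for x
  define A where "A = gen sd_gen.a"
  define B where "B = gen sd_gen.b"
  have gen: "gen x \<in> carrier ?G" for x
    by (auto simp: gen_def G presented_group_def quotient_def)
  then have AB [simp]: "A \<in> carrier ?G" "B \<in> carrier ?G"
    by (simp_all add: A_def B_def)
  have rel: "word_value ?G gen r = word_value ?G gen s" if "(r, s) \<in> R" for r s
    using presented_group_relation[OF that] by (simp only: G gen_def[abs_def])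
  note power = G.word_value_replicate[of gen, OF gen]
  have "(replicate (4 * n) (Gen sd_gen.a), []) \<in> R" unfolding R_def by blast
  from rel[OF this] have A_order: "A [^]\<^bsub>?G\<^esub> (4 * n) = \<one>\<^bsub>?G\<^esub>"
    by (simp add: power A_def)
  have "([Gen sd_gen.b, Gen sd_gen.b], []) \<in> R" unfolding R_def by blast
  from rel[OF this] have B_order: "B \<otimes>\<^bsub>?G\<^esub> B = \<one>\<^bsub>?G\<^esub>"
    by (simp add: B_def gen)
  have B_inv: "inv\<^bsub>?G\<^esub> B = B"
    using B_order by (intro G.inv_equality) simp_all
  have "([Gen sd_gen.b, Gen sd_gen.a, Inv sd_gen.b], replicate (2 * n - 1) (Gen sd_gen.a)) \<in> R"
    unfolding R_def by blast
  from rel[OF this]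
  have "B \<otimes>\<^bsub>?G\<^esub> A \<otimes>\<^bsub>?G\<^esub> inv\<^bsub>?G\<^esub> B = A [^]\<^bsub>?G\<^esub> (2 * n - 1)"
    by (simp add: power A_def B_def gen G.m_assoc)
  also have "\<dots> = A [^]\<^bsub>?G\<^esub> (2 * int n - 1)"
    using assms int_pow_int[of ?G A "2 * n - 1"] by (simp add: of_nat_diff)
  finally have conj: "B \<otimes>\<^bsub>?G\<^esub> A \<otimes>\<^bsub>?G\<^esub> inv\<^bsub>?G\<^esub> B = A [^]\<^bsub>?G\<^esub> (2 * int n - 1)" .
  have "(\<lambda>x. B \<otimes>\<^bsub>?G\<^esub> x \<otimes>\<^bsub>?G\<^esub> inv\<^bsub>?G\<^esub> B) \<in> hom ?G ?G"
    by (rule homI) (simp_all add: G.m_assoc G.inv_solve_left' flip: G.m_assoc[of "inv\<^bsub>?G\<^esub> B" B])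
  from hom_int_pow[OF this AB(1) G.is_group G.is_group]
  have "B \<otimes>\<^bsub>?G\<^esub> A [^]\<^bsub>?G\<^esub> i \<otimes>\<^bsub>?G\<^esub> inv\<^bsub>?G\<^esub> B = A [^]\<^bsub>?G\<^esub> ((2 * int n - 1) * i)" for i :: int
    by (simp add: conj G.int_pow_pow)
  then have swap: "B \<otimes>\<^bsub>?G\<^esub> A [^]\<^bsub>?G\<^esub> i = A [^]\<^bsub>?G\<^esub> ((2 * int n - 1) * i) \<otimes>\<^bsub>?G\<^esub> B" for i :: int
    by (metis AB G.int_pow_closed G.inv_solve_right G.m_closed)
  have A_mod: "A [^]\<^bsub>?G\<^esub> (i mod ?m) = A [^]\<^bsub>?G\<^esub> i" for i :: int
  proof -
    have "A [^]\<^bsub>?G\<^esub> ?m = \<one>\<^bsub>?G\<^esub>"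
      using A_order by (metis int_pow_int of_nat_mult of_nat_numeral)
    then have "A [^]\<^bsub>?G\<^esub> (?m * (i div ?m)) = \<one>\<^bsub>?G\<^esub>"
      by (metis AB(1) G.int_pow_one G.int_pow_pow)
    then have "A [^]\<^bsub>?G\<^esub> (?m * (i div ?m) + i mod ?m) = A [^]\<^bsub>?G\<^esub> (i mod ?m)"
      by (simp only: G.int_pow_mult AB G.l_one G.int_pow_closed)
    then show ?thesis by simp
  qed
  define nf where "nf = (\<lambda>(i :: int, e). A [^]\<^bsub>?G\<^esub> i \<otimes>\<^bsub>?G\<^esub> (if e then B else \<one>\<^bsub>?G\<^esub>))"
  have nf_closed: "nf p \<in> carrier ?G" for p
    by (simp add: nf_def split: prod.split)
  have A_nf: "A [^]\<^bsub>?G\<^esub> (j :: int) \<otimes>\<^bsub>?G\<^esub> nf (i, e) = nf (j + i, e)" for i j e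
    by (simp add: nf_def G.int_pow_mult G.m_assoc)
  have B_nf: "B \<otimes>\<^bsub>?G\<^esub> nf (i, e) = nf ((2 * int n - 1) * i, \<not> e)" for i e
    by (simp add: nf_def flip: G.m_assoc) (simp add: swap G.m_assoc B_order)
  \<comment> \<open>The normal forms are closed under left multiplication by the letters, hence contain all words.\<close>
  have "word_value ?G gen w \<in> range nf" for w
  proof (induction w)
    case Nil
    have "nf (0, False) = \<one>\<^bsub>?G\<^esub>" by (simp add: nf_def)
    then show ?case by (metis range_eqI word_value.simps(1))
  next
    case (Cons l w)
    then obtain i e where w: "word_value ?G gen w = nf (i, e)" by auto
    have "A \<otimes>\<^bsub>?G\<^esub> nf (i, e) \<in> range nf" "inv\<^bsub>?G\<^esub> A \<otimes>\<^bsub>?G\<^esub> nf (i, e) \<in> range nf"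
      using A_nf[of 1 i e] A_nf[of "-1" i e] by (simp_all add: G.int_pow_neg)
    moreover have "B \<otimes>\<^bsub>?G\<^esub> nf (i, e) \<in> range nf"
      by (simp add: B_nf)
    ultimately show ?case
      by (cases l; cases "case l of Gen x \<Rightarrow> x | Inv x \<Rightarrow> x")
        (simp_all add: w B_inv flip: A_def B_def)
  qed
  then have class_nf: "word_cong R `` {w} \<in> range nf" for w
    using presented_group_word_value[of R] by (simp only: G gen_def[abs_def])
  have "carrier ?G \<subseteq> range nf"
  proof
    fix x assume "x \<in> carrier ?G"
    then obtain w where "x = word_cong R `` {w}"
      by (auto simp: G presented_group_def quotient_def)
    with class_nf show "x \<in> range nf" by simp
  qed
  then have nf_onto: "\<exists>i e. i \<in> {0..<?m} \<and> x = nf (i, e)" if "x \<in> carrier ?G" for x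
  proof -
    obtain p where "x = nf p" using \<open>carrier ?G \<subseteq> range nf\<close> \<open>x \<in> carrier ?G\<close> by blast
    then obtain i e where "x = nf (i, e)" by (cases p) blast
    then have "x = nf (i mod ?m, e)" by (simp add: nf_def A_mod)
    then show ?thesis using assms by (intro exI[of _ "i mod ?m"] exI[of _ e]) simp
  qed
  define val where "val x = (case x of sd_gen.a \<Rightarrow> (1 :: int, False) | sd_gen.b \<Rightarrow> (0, True))" for x
  have val: "val x \<in> carrier ?M" for x
    using assms by (cases x) (simp_all add: val_def sd_model_simps)
  have B_model: "inv\<^bsub>?M\<^esub> (0, True) = (0, True)"
    by (rule M.inv_equality) (use assms in \<open>simp_all add: sd_model_simps\<close>)
  have val_pow: "word_value ?M val (replicate k (Gen sd_gen.a)) = (int k mod ?m, False)" for k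
    using M.word_value_replicate[of val k sd_gen.a, OF val] sd_model_powers[OF assms, of "int k"]
    by (simp add: val_def int_pow_int)
  have "word_value ?M val (replicate (4 * n) (Gen sd_gen.a)) = word_value ?M val []"
    by (simp add: val_pow sd_model_simps(3))
  moreover have "word_value ?M val [Gen sd_gen.b, Gen sd_gen.b] = word_value ?M val []"
    by (simp add: val_def sd_model_simps)
  moreover have "word_value ?M val [Gen sd_gen.b, Gen sd_gen.a, Inv sd_gen.b]
      = word_value ?M val (replicate (2 * n - 1) (Gen sd_gen.a))"
    using assms unfolding val_pow
    by (simp add: val_def B_model sd_model_simps sd_twist_def of_nat_diff)
  ultimately have rel_model: "word_value ?M val r = word_value ?M val s" if "(r, s) \<in> R" for r s
    using that unfolding R_def by blast
  obtain \<phi> where hom: "\<phi> \<in> hom ?G ?M"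
      and \<phi>: "\<And>w. \<phi> (word_cong R `` {w}) = word_value ?M val w"
    using M.presented_group_hom[of val R, OF val rel_model] unfolding G by blast
  have \<phi>_gen: "\<phi> A = (1, False)" "\<phi> B = (0, True)"
    using \<phi>[of "[Gen sd_gen.a]"] \<phi>[of "[Gen sd_gen.b]"] assms
    by (simp_all add: A_def B_def gen_def val_def sd_model_simps)
  have \<phi>_nf: "\<phi> (nf (i, e)) = (i mod ?m, e)" for i e
  proof -
    have "\<phi> (A [^]\<^bsub>?G\<^esub> i) = (i mod ?m, False)"
      using hom_int_pow[OF hom AB(1) G.is_group M.is_group, of i]
      by (simp add: \<phi>_gen sd_model_powers assms)
    moreover have "\<phi> \<one>\<^bsub>?G\<^esub> = (0, False)"
      using hom_one[OF hom G.is_group M.is_group] by (simp add: sd_model_simps)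
    moreover have "\<phi> (nf (i, e)) = \<phi> (A [^]\<^bsub>?G\<^esub> i) \<otimes>\<^bsub>?M\<^esub> \<phi> (if e then B else \<one>\<^bsub>?G\<^esub>)"
      unfolding nf_def by (simp add: hom_mult[OF hom])
    ultimately show ?thesis by (simp add: \<phi>_gen sd_model_simps)
  qed
  have "inj_on \<phi> (carrier ?G)"
  proof (rule inj_onI)
    fix x y assume "x \<in> carrier ?G" "y \<in> carrier ?G" and eq: "\<phi> x = \<phi> y"
    then obtain i e j f where "i \<in> {0..<?m}" "x = nf (i, e)" "j \<in> {0..<?m}" "y = nf (j, f)"
      using nf_onto by metis
    then show "x = y" using eq by (simp add: \<phi>_nf)
  qed
  moreover have "\<phi> ` carrier ?G = carrier ?M"
  proof
    show "\<phi> ` carrier ?G \<subseteq> carrier ?M" using hom by (auto simp: hom_def)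
    show "carrier ?M \<subseteq> \<phi> ` carrier ?G"
    proof
      fix p assume "p \<in> carrier ?M"
      then have "p = \<phi> (nf p)" by (cases p) (simp add: \<phi>_nf sd_model_simps)
      then show "p \<in> \<phi> ` carrier ?G" using nf_closed by blast
    qed
  qed
  ultimately show ?thesis using hom by (auto simp: iso_def bij_betw_def)
qed

section \<open>Adjacency of rotations and reflections\<close>

text \<open>
  The least positive exponent of a central power of \<open>a\<close>.
\<close>

definition sd_centre :: "nat \<Rightarrow> int" where
  "sd_centre n = (if even n then 2 * int n else int n)"

text \<open>
  Colour 0 is given to the central rotations, 1 to the other rotations, and 2 and 3 to the reflections,
  which for even \<open>n\<close> form two conjugacy classes, one for each parity of the exponent.
\<close>

definition sd_colour :: "nat \<Rightarrow> int \<times> bool \<Rightarrow> nat" where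
  "sd_colour n = (\<lambda>(i, e). if e then (if even n \<and> odd i then 3 else 2)
     else (if sd_centre n dvd i then 0 else 1))"

definition joined :: "nat \<Rightarrow> nat \<Rightarrow> bool" where
  "joined c d \<longleftrightarrow> c = 0 \<or> d = 0 \<or> c = d"

text \<open>
  Dividing by 2, the condition is \<open>2n dvd (n - 1) x\<close>. For even \<open>n\<close> the numbers \<open>2n\<close> and \<open>n - 1\<close> are
  coprime. For odd \<open>n = 2q + 1\<close> a further factor 2 cancels and leaves \<open>n dvd q x\<close>, where \<open>n\<close> and
  \<open>q\<close> are coprime.
\<close>

lemma sd_centre_dvd_iff: "4 * int n dvd (2 * int n - 2) * x \<longleftrightarrow> sd_centre n dvd x"
proof (cases "even n")
  case True
  then have "odd (int n - 1)" by simp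
  then have "coprime (2 * int n) (int n - 1)"
    using coprime_doff_one_right[of "int n"] by (simp add: coprime_left_2_iff_odd)
  then have "2 * int n dvd (int n - 1) * x \<longleftrightarrow> 2 * int n dvd x"
    by (rule coprime_dvd_mult_right_iff)
  moreover have "4 * int n dvd (2 * int n - 2) * x \<longleftrightarrow> 2 * (2 * int n) dvd 2 * ((int n - 1) * x)"
    by (simp add: algebra_simps)
  moreover have "2 * (2 * int n) dvd 2 * ((int n - 1) * x) \<longleftrightarrow> 2 * int n dvd (int n - 1) * x"
    by (subst dvd_mult_cancel_left) simp
  ultimately show ?thesis
    using True by (simp only: sd_centre_def if_True)
next
  case False
  then obtain q where q: "int n = 2 * q + 1" by (metis even_of_nat oddE)
  have "coprime (2 * q + 1) q"
    by (rule coprimeI) (metis dvd_add_right_iff dvd_mult)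
  then have "int n dvd q * x \<longleftrightarrow> int n dvd x"
    unfolding q by (rule coprime_dvd_mult_right_iff)
  moreover have "4 * int n dvd (2 * int n - 2) * x \<longleftrightarrow> 4 * int n dvd 4 * (q * x)"
    by (simp add: q algebra_simps)
  moreover have "4 * int n dvd 4 * (q * x) \<longleftrightarrow> int n dvd q * x"
    by (subst dvd_mult_cancel_left) simp
  ultimately show ?thesis
    using False by (simp only: sd_centre_def if_False)
qed

text \<open>
  Central powers of \<open>a\<close> stay central under conjugation: \<open>(2n - 1) i\<close> and \<open>-i\<close> agree modulo \<open>2n\<close>, a multiple of
  \<open>sd_centre n\<close>.
\<close>

lemma sd_centre_dvd_twist: "sd_centre n dvd sd_twist n f i \<longleftrightarrow> sd_centre n dvd i"
proof -
  have "sd_centre n dvd 2 * int n * i" by (simp add: sd_centre_def)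
  then have "sd_centre n dvd 2 * int n * i - i \<longleftrightarrow> sd_centre n dvd i"
    by (metis dvd_diff_commute dvd_diff_right_iff)
  then show ?thesis by (simp add: sd_twist_def algebra_simps)
qed

text \<open>
  The left-hand side says that some conjugate of the reflection \<open>a^i b\<close>, by \<open>a^j b^f\<close>, commutes
  with \<open>a^l b\<close>. For even \<open>n\<close> both the modulus \<open>2n\<close> and the coefficient of \<open>j\<close> are even and twisting
  preserves parity, so parity is an invariant. Conversely, \<open>f\<close> can be taken trivial and \<open>j\<close> found by
  solving a linear congruence.
\<close>

lemma sd_reflections_commute_iff:
  "(\<exists>j f. sd_centre n dvd l - sd_twist n f i + (2 * int n - 2) * j)
    \<longleftrightarrow> (even n \<longrightarrow> (even i \<longleftrightarrow> even l))"
proof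
  assume "\<exists>j f. sd_centre n dvd l - sd_twist n f i + (2 * int n - 2) * j"
  then obtain j f where jf: "sd_centre n dvd l - sd_twist n f i + (2 * int n - 2) * j" by blast
  show "even n \<longrightarrow> (even i \<longleftrightarrow> even l)"
  proof
    assume "even n"
    then have "2 dvd l - sd_twist n f i + (2 * int n - 2) * j"
      using dvd_trans[OF _ jf, of 2] by (simp add: sd_centre_def)
    then show "even i \<longleftrightarrow> even l" by (auto simp: sd_twist_def split: if_splits)
  qed
next
  assume parity: "even n \<longrightarrow> (even i \<longleftrightarrow> even l)"
  have "\<exists>j. sd_centre n dvd l - i + (2 * int n - 2) * j"
  proof (cases "even n")
    case True
    then have "even (l - i)" using parity by simp
    then obtain k where k: "l - i = 2 * k" by (rule evenE)
    \<comment> \<open>With \<open>l - i = 2k\<close>, the choice \<open>j = k\<close> gives \<open>2k + (2n - 2)k = 2nk\<close>.\<close>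
    have "l - i + (2 * int n - 2) * k = 2 * int n * k"
      unfolding k by (simp add: algebra_simps)
    then show ?thesis using True by (metis dvd_triv_left sd_centre_def)
  next
    case False
    then obtain q where q: "int n = 2 * q + 1" by (metis even_of_nat oddE)
    \<comment> \<open>Modulo \<open>n\<close> the equation is \<open>2j = l - i\<close>, and \<open>q + 1\<close> is the inverse of 2.\<close>
    have "l - i + (2 * int n - 2) * ((l - i) * (q + 1)) = int n * (int n * (l - i))"
      by (simp add: q algebra_simps)
    then show ?thesis using False by (metis dvd_triv_left sd_centre_def)
  qed
  then have "\<exists>j. sd_centre n dvd l - sd_twist n False i + (2 * int n - 2) * j" by simp
  then show "\<exists>j f. sd_centre n dvd l - sd_twist n f i + (2 * int n - 2) * j" by blast
qed

text \<open>
  The conjugate of \<open>(i, e)\<close> by \<open>(j, f)\<close> is \<open>(t, e)\<close>, so the criterion for adjacency becomes a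
  congruence in unreduced integers \<open>j\<close>.
\<close>

lemma sd_conjugate_commutes_iff:
  assumes "n > 0"
  shows "(\<exists>k\<in>carrier (sd_model n). \<exists>x\<in>carrier (sd_model n).
      k \<otimes>\<^bsub>sd_model n\<^esub> x = x \<otimes>\<^bsub>sd_model n\<^esub> (i, e)
        \<and> k \<otimes>\<^bsub>sd_model n\<^esub> (l, e') = (l, e') \<otimes>\<^bsub>sd_model n\<^esub> k)
    \<longleftrightarrow> (\<exists>j f. let t = j + sd_twist n f i - sd_twist n e j in
          [t + sd_twist n e l = l + sd_twist n e' t] (mod (4 * int n)))"
    (is "?L \<longleftrightarrow> ?R")
proof
  assume ?L
  then obtain t e2 j f where
    1: "(t, e2) \<otimes>\<^bsub>sd_model n\<^esub> (j, f) = (j, f) \<otimes>\<^bsub>sd_model n\<^esub> (i, e)" and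
    2: "(t, e2) \<otimes>\<^bsub>sd_model n\<^esub> (l, e') = (l, e') \<otimes>\<^bsub>sd_model n\<^esub> (t, e2)"
    by fast
  have e2: "e2 = e" using 1 by (auto simp: sd_model_simps)
  let ?t = "j + sd_twist n f i - sd_twist n e j"
  have "[t + sd_twist n e j = j + sd_twist n f i] (mod (4 * int n))"
    using 1 by (simp add: sd_model_simps e2 cong_def)
  then have t: "[?t = t] (mod (4 * int n))"
    by (metis add_diff_cancel_right' cong_diff cong_refl cong_sym)
  have tw: "[sd_twist n e' ?t = sd_twist n e' t] (mod (4 * int n))"
    using t by (auto simp: sd_twist_def intro: cong_mult)
  have "[?t + sd_twist n e l = t + sd_twist n e l] (mod (4 * int n))"
    by (intro cong_add t cong_refl)
  also have "[t + sd_twist n e l = l + sd_twist n e' t] (mod (4 * int n))"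
    using 2 by (simp add: sd_model_simps e2 cong_def)
  also have "[l + sd_twist n e' t = l + sd_twist n e' ?t] (mod (4 * int n))"
    by (intro cong_add cong_refl cong_sym[OF tw])
  finally show ?R unfolding Let_def by blast
next
  assume ?R
  then obtain j f where
    jf: "[j + sd_twist n f i - sd_twist n e j + sd_twist n e l
      = l + sd_twist n e' (j + sd_twist n f i - sd_twist n e j)] (mod (4 * int n))"
    unfolding Let_def by blast
  define t where "t = j + sd_twist n f i - sd_twist n e j"
  let ?m = "4 * int n"
  have "[t mod ?m + sd_twist n e (j mod ?m) = t + sd_twist n e j] (mod ?m)"
    by (intro cong_add sd_twist_mod) (simp add: cong_def)
  also have "t + sd_twist n e j = j + sd_twist n f i" by (simp add: t_def)
  also have "[j + sd_twist n f i = j mod ?m + sd_twist n f i] (mod ?m)"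
    by (intro cong_add cong_refl) (simp add: cong_def)
  finally have 1: "(t mod ?m, e) \<otimes>\<^bsub>sd_model n\<^esub> (j mod ?m, f) = (j mod ?m, f) \<otimes>\<^bsub>sd_model n\<^esub> (i, e)"
    by (auto simp: sd_model_simps cong_def)
  have "[t mod ?m + sd_twist n e l = t + sd_twist n e l] (mod ?m)"
    by (intro cong_add cong_refl) (simp add: cong_def)
  also have "[t + sd_twist n e l = l + sd_twist n e' t] (mod ?m)"
    using jf by (simp add: t_def)
  also have "[l + sd_twist n e' t = l + sd_twist n e' (t mod ?m)] (mod ?m)"
    by (intro cong_add cong_refl cong_sym[OF sd_twist_mod])
  finally have 2: "(t mod ?m, e) \<otimes>\<^bsub>sd_model n\<^esub> (l, e') = (l, e') \<otimes>\<^bsub>sd_model n\<^esub> (t mod ?m, e)"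
    by (auto simp: sd_model_simps cong_def)
  have "(t mod ?m, e) \<in> carrier (sd_model n)" "(j mod ?m, f) \<in> carrier (sd_model n)"
    using assms by (simp_all add: sd_model_simps)
  with 1 2 show ?L by blast
qed

lemma sd_model_arc_iff:
  assumes "n > 0" and "p \<in> carrier (sd_model n)" "q \<in> carrier (sd_model n)"
  shows "(p, q) \<in> parcs (CSCom (sd_model n))
    \<longleftrightarrow> p \<noteq> q \<and> joined (sd_colour n p) (sd_colour n q)"
proof -
  obtain i e l e' where pq: "p = (i, e)" "q = (l, e')" by (cases p, cases q) blast
  let ?C = "\<exists>j f. let t = j + sd_twist n f i - sd_twist n e j in
      [t + sd_twist n e l = l + sd_twist n e' t] (mod (4 * int n))"
  have "?C \<longleftrightarrow> joined (sd_colour n p) (sd_colour n q)"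
  proof (cases e; cases e')
    assume e: "\<not> e" "\<not> e'"
    then show ?thesis by (auto simp: pq joined_def sd_colour_def add.commute)
  next
    assume e: "\<not> e" "e'"
    have "[t + l = l + sd_twist n True t] (mod (4 * int n)) \<longleftrightarrow> sd_centre n dvd t" for t
      unfolding sd_centre_dvd_iff[symmetric] cong_iff_dvd_diff
      by (subst dvd_minus_iff[symmetric]) (simp add: sd_twist_def algebra_simps)
    then show ?thesis
      using e by (auto simp: pq joined_def sd_colour_def sd_centre_dvd_twist)
  next
    assume e: "e" "\<not> e'"
    have "[t + sd_twist n True l = l + t] (mod (4 * int n)) \<longleftrightarrow> sd_centre n dvd l" for t
      unfolding sd_centre_dvd_iff[symmetric] cong_iff_dvd_diff
      by (simp add: sd_twist_def algebra_simps)
    then show ?thesis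
      using e by (auto simp: pq joined_def sd_colour_def)
  next
    assume e: "e" "e'"
    have comm: "[t + sd_twist n True l = l + sd_twist n True t] (mod (4 * int n))
        \<longleftrightarrow> sd_centre n dvd l - t" for t
      unfolding sd_centre_dvd_iff[symmetric] cong_iff_dvd_diff
      by (simp add: sd_twist_def algebra_simps)
    have conj: "l - (j + sd_twist n f i - sd_twist n True j)
        = l - sd_twist n f i + (2 * int n - 2) * j" for j f
      by (simp add: sd_twist_def[of n True] algebra_simps)
    have "?C \<longleftrightarrow> (\<exists>j f. sd_centre n dvd l - sd_twist n f i + (2 * int n - 2) * j)"
      unfolding Let_def eqTrueI[OF e(1)] eqTrueI[OF e(2)] comm conj ..
    then have "?C \<longleftrightarrow> (even n \<longrightarrow> (even i \<longleftrightarrow> even l))"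
      unfolding sd_reflections_commute_iff .
    then show ?thesis
      using e by (auto simp: pq joined_def sd_colour_def)
  qed
  then show ?thesis
    using group.CSCom_arc_iff[OF sd_model_group[OF assms(1)] assms(2,3)]
      sd_conjugate_commutes_iff[OF assms(1), of i e l e'] unfolding pq by simp
qed

section \<open>Counting the colours\<close>

lemma card_multiples:
  fixes d :: int
  assumes "d > 0"
  shows "card {i \<in> {0..<d * int q}. d dvd i} = q"
proof -
  have "{i \<in> {0..<d * int q}. d dvd i} = (\<lambda>k. d * int k) ` {..<q}"
  proof (intro equalityI subsetI)
    fix i assume "i \<in> {i \<in> {0..<d * int q}. d dvd i}"
    then obtain k where k: "i = d * k" "0 \<le> d * k" "d * k < d * int q" by (auto elim: dvdE)
    then have "0 \<le> k" "k < int q"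
      using assms by (simp_all add: zero_le_mult_iff mult_less_cancel_left)
    then show "i \<in> (\<lambda>k. d * int k) ` {..<q}"
      using k(1) by (intro image_eqI[of _ _ "nat k"]) auto
  qed (use assms in auto)
  moreover have "inj_on (\<lambda>k. d * int k) {..<q}" using assms by (auto intro: inj_onI)
  ultimately show ?thesis by (simp add: card_image)
qed

lemma card_sd_colour:
  assumes "n > 0"
  shows "card {p \<in> carrier (sd_model n). sd_colour n p = k} =
    (if even n then (if k = 0 then 2 else if k = 1 then 4 * n - 2 else if k < 4 then 2 * n else 0)
     else (if k = 0 then 4 else if k = 1 then 4 * n - 4 else if k = 2 then 4 * n else 0))"
proof -
  let ?I = "{0..<4 * int n}"
  let ?rot = "\<lambda>P. {i \<in> ?I. P i} \<times> {False}" and ?refl = "\<lambda>P. {i \<in> ?I. P i} \<times> {True}"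
  let ?q = "if even n then 2 else 4 :: nat"
  have q: "4 * int n = sd_centre n * int ?q" by (simp add: sd_centre_def)
  have centre: "card {i \<in> ?I. sd_centre n dvd i} = ?q"
    unfolding q by (rule card_multiples) (use assms in \<open>simp add: sd_centre_def\<close>)
  have two: "4 * int n = 2 * int (2 * n)" by simp
  have evens: "card {i \<in> ?I. even i} = 2 * n"
    unfolding two by (rule card_multiples) simp
  have compl: "card {i \<in> ?I. \<not> P i} = 4 * n - card {i \<in> ?I. P i}" for P
  proof -
    have "{i \<in> ?I. \<not> P i} = ?I - {i \<in> ?I. P i}" by blast
    moreover have "card (?I - {i \<in> ?I. P i}) = card ?I - card {i \<in> ?I. P i}"
      by (rule card_Diff_subset) (auto intro: finite_subset[of _ ?I])
    moreover have "card ?I = 4 * n" by simp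
    ultimately show ?thesis by (simp only:)
  qed
  have fibre: "{p \<in> carrier (sd_model n). sd_colour n p = k} =
    (if k = 0 then ?rot (\<lambda>i. sd_centre n dvd i)
     else if k = 1 then ?rot (\<lambda>i. \<not> sd_centre n dvd i)
     else if k = 2 then ?refl (\<lambda>i. even n \<longrightarrow> even i)
     else if k = 3 then ?refl (\<lambda>i. even n \<and> odd i) else {})"
    by (auto simp: sd_model_simps sd_colour_def split: if_splits)
  show ?thesis
    unfolding fibre
    by (auto simp: card_cartesian_product centre evens compl simp del: atLeastLessThan_iff)
qed

text \<open>
  The colouring of the model is pulled back along the isomorphism.
\<close>

lemma CSCom_semidihedral_blow_up:
  assumes "n > 0"
  obtains c where "blow_up joined c (CSCom (semidihedral_group n))"
    "\<And>k. card {x \<in> pverts (CSCom (semidihedral_group n)). c x = k}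
      = card {p \<in> carrier (sd_model n). sd_colour n p = k}"
proof -
  let ?G = "semidihedral_group n" and ?M = "sd_model n"
  obtain \<phi> where \<phi>: "\<phi> \<in> iso ?G ?M"
    using semidihedral_iso_model[OF assms] by blast
  then have inj: "inj_on \<phi> (carrier ?G)" and img: "\<phi> ` carrier ?G = carrier ?M"
    by (auto simp: iso_def bij_betw_def)
  have G: "group ?G"
    unfolding semidihedral_group_def by (rule presented_group_is_group)
  have arc: "(x, y) \<in> parcs (CSCom ?G) \<longleftrightarrow>
      x \<noteq> y \<and> joined (sd_colour n (\<phi> x)) (sd_colour n (\<phi> y))"
    if "x \<in> carrier ?G" "y \<in> carrier ?G" for x y
  proof -
    have "\<phi> x \<in> carrier ?M" "\<phi> y \<in> carrier ?M" "\<phi> x = \<phi> y \<longleftrightarrow> x = y"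
      using that img inj by (auto dest: inj_onD)
    then show ?thesis
      using CSCom_arc_iso[OF G sd_model_group[OF assms] \<phi> that] sd_model_arc_iff[OF assms] by simp
  qed
  have "finite (carrier ?G)"
    using finite_imageD[OF _ inj] img by (simp add: sd_model_simps)
  moreover have "parcs (CSCom ?G) \<subseteq> carrier ?G \<times> carrier ?G" "pverts (CSCom ?G) = carrier ?G"
    by (auto simp: CSCom_def)
  ultimately have "blow_up joined (\<lambda>x. sd_colour n (\<phi> x)) (CSCom ?G)"
    unfolding blow_up_def using arc by auto
  moreover have "card {x \<in> carrier ?G. sd_colour n (\<phi> x) = k}
      = card {p \<in> carrier ?M. sd_colour n p = k}" for k
  proof (rule bij_betw_same_card)
    show "bij_betw \<phi> {x \<in> carrier ?G. sd_colour n (\<phi> x) = k} {p \<in> carrier ?M. sd_colour n p = k}"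
      using inj by (auto simp: bij_betw_def simp flip: img intro: inj_on_subset)
  qed
  ultimately show ?thesis
    using that \<open>pverts (CSCom ?G) = carrier ?G\<close> by simp
qed

section \<open>The target graphs\<close>

text \<open>
  The colouring of \<open>K_r \<or> (K_s \<squnion> Q)\<close> that extends a colouring \<open>h\<close> of \<open>Q\<close>: colour 0 for the part that is
  joined to everything, and colour 1 for \<open>K_s\<close>. Hence \<open>h\<close> has to avoid the colours 0 and 1.
\<close>

definition join_colour :: "('c \<Rightarrow> nat) \<Rightarrow> 'a + 'b + 'c \<Rightarrow> nat" where
  "join_colour h = case_sum (\<lambda>_. 0) (case_sum (\<lambda>_. 1) h)"

lemma blow_up_join:
  assumes "blow_up (=) h Q" and "\<And>v. h v \<ge> 2"
  shows "blow_up joined (join_colour h)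
    (graph_join (complete_graph r) (disjoint_union (complete_graph s) Q))"
proof -
  have [simp]: "h v \<noteq> 0" "h v \<noteq> Suc 0" "Suc 0 \<noteq> h v" for v
    using assms(2)[of v] by auto
  show ?thesis
    using assms(1) unfolding blow_up_def graph_join_def disjoint_union_def complete_graph_def
    by (auto simp: joined_def join_colour_def image_iff)
qed

lemma card_join_colour:
  assumes "\<And>v. h v \<ge> 2"
  shows "card {v \<in> pverts (graph_join (complete_graph r) (disjoint_union (complete_graph s) Q)).
      join_colour h v = k}
    = (if k = 0 then r else if k = 1 then s else card {v \<in> pverts Q. h v = k})"
proof -
  have [simp]: "h v \<noteq> 0" "h v \<noteq> Suc 0" for v
    using assms[of v] by auto
  have "{v \<in> pverts (graph_join (complete_graph r) (disjoint_union (complete_graph s) Q)).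
      join_colour h v = k}
    = (if k = 0 then Inl ` {..<r} else if k = 1 then (Inr \<circ> Inl) ` {..<s}
       else (Inr \<circ> Inr) ` {v \<in> pverts Q. h v = k})"
    by (auto simp: graph_join_def disjoint_union_def complete_graph_def join_colour_def)
  then show ?thesis by (simp add: card_image inj_on_def)
qed

lemma blow_up_complete_graph: "blow_up (=) (\<lambda>_. c) (complete_graph r)"
  by (auto simp: blow_up_def complete_graph_def)

text \<open>
  Each copy is a clique with a colour of its own.
\<close>

lemma blow_up_copies: "blow_up (=) (\<lambda>(i, _). c + i) (copies m (complete_graph r))"
  by (auto simp: blow_up_def copies_def complete_graph_def)

section \<open>The conjugacy super commuting graph of the semidihedral group\<close>

theorem theorem2p6:
  fixes n :: nat
  assumes "n \<ge> 2"
  shows "(even n \<longrightarrow>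
           digraph_iso (with_proj (CSCom (semidihedral_group n)))
             (with_proj (graph_join (complete_graph 2)
               (disjoint_union (complete_graph (4 * n - 2)) (copies 2 (complete_graph (2 * n))))))) \<and>
         (odd n \<longrightarrow>
           digraph_iso (with_proj (CSCom (semidihedral_group n)))
             (with_proj (graph_join (complete_graph 4)
               (disjoint_union (complete_graph (4 * n - 4)) (complete_graph (4 * n))))))"
proof -
  have n: "n > 0" using assms by simp
  obtain c where c: "blow_up joined c (CSCom (semidihedral_group n))"
    and card_c: "\<And>k. card {x \<in> pverts (CSCom (semidihedral_group n)). c x = k}
      = card {p \<in> carrier (sd_model n). sd_colour n p = k}"
    using CSCom_semidihedral_blow_up[OF n] by blast
  show ?thesis
  proof (intro conjI impI)
    assume "even n"
    let ?h = "\<lambda>(i :: nat, _ :: nat). 2 + i"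
    have h: "?h v \<ge> 2" for v by (cases v) simp
    have fibre: "{v \<in> pverts (copies 2 (complete_graph (2 * n))). ?h v = k}
        = (if k = 2 \<or> k = 3 then {k - 2} \<times> {..<2 * n} else {})" for k
      by (auto simp: copies_def complete_graph_def)
    show "digraph_iso (with_proj (CSCom (semidihedral_group n)))
        (with_proj (graph_join (complete_graph 2)
          (disjoint_union (complete_graph (4 * n - 2)) (copies 2 (complete_graph (2 * n))))))"
    proof (rule blow_up_iso[OF c blow_up_join[OF blow_up_copies h]])
      fix k
      show "card {x \<in> pverts (CSCom (semidihedral_group n)). c x = k} =
        card {v \<in> pverts (graph_join (complete_graph 2)
          (disjoint_union (complete_graph (4 * n - 2)) (copies 2 (complete_graph (2 * n))))).
          join_colour ?h v = k}"
        unfolding card_c card_join_colour[of ?h, OF h] fibre card_sd_colour[OF n]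
        using \<open>even n\<close> by auto
    qed
  next
    assume "odd n"
    have h: "(\<lambda>_. 2) v \<ge> (2 :: nat)" for v :: nat by simp
    show "digraph_iso (with_proj (CSCom (semidihedral_group n)))
        (with_proj (graph_join (complete_graph 4)
          (disjoint_union (complete_graph (4 * n - 4)) (complete_graph (4 * n)))))"
    proof (rule blow_up_iso[OF c blow_up_join[OF blow_up_complete_graph[of 2] h]])
      fix k
      show "card {x \<in> pverts (CSCom (semidihedral_group n)). c x = k} =
        card {v \<in> pverts (graph_join (complete_graph 4)
          (disjoint_union (complete_graph (4 * n - 4)) (complete_graph (4 * n)))).
          join_colour (\<lambda>_. 2) v = k}"
        unfolding card_c card_join_colour[of "\<lambda>_. 2", OF h] card_sd_colour[OF n]
        using \<open>odd n\<close> by (auto simp: complete_graph_def)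
    qed
  qed
qed

end
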